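(* Let $a,s,b$ be three distinct vertices of the randomly oriented complete graph $K_n$, $n\ge 3$, and let $A=\{a\nrightarrow s\}$ and $B=\{s\nrightarrow b\}$. Then $A$ and $B$ are negatively correlated for $n=3$, independent for $n=4$, and positively correlated for every $n\ge 5$.
   Context: The complete graph $K_n$ on the vertex set $[n]=\{1,\dots,n\}$ is randomly oriented: each edge is independently given one of its two possible directions, each with probability $\frac12$. For vertices $u\neq v$, $\{u\to v\}$ is the event that there is a directed path from $u$ to $v$, and $\{u\nrightarrow v\}$ is its complement. Two events $A,B$ are negatively correlated if $P(A\cap B)<P(A)P(B)$ and positively correlated if $P(A\cap B)>P(A)P(B)$. *)

theory Defs
  imports "HOL-Probability.Probability" "HOL-Probability.Product_PMF"
begin

definition K_edges :: "nat \<Rightarrow> nat set set" where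
  "K_edges n = {e. e \<subseteq> {1..n} \<and> card e = 2}"

(* An orientation assigns to every edge its head, i.e. the endpoint it points to. *)
type_synonym orientation = "nat set \<Rightarrow> nat"

definition arcs :: "nat \<Rightarrow> orientation \<Rightarrow> (nat \<times> nat) set" where
  "arcs n h = {(u, v). u \<noteq> v \<and> {u, v} \<in> K_edges n \<and> h {u, v} = v}"

(* Every edge independently gets a uniformly chosen endpoint as its head. The 0 is the
   irrelevant value, forced by Pi_pmf, of h on sets that are not edges. *)
definition random_orientation :: "nat \<Rightarrow> orientation pmf" where
  "random_orientation n = Pi_pmf (K_edges n) 0 (\<lambda>e. pmf_of_set e)"

definition dipath :: "('a \<times> 'a) set \<Rightarrow> 'a \<Rightarrow> 'a list \<Rightarrow> 'a \<Rightarrow> bool" where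
  "dipath R u p v \<longleftrightarrow> p \<noteq> [] \<and> hd p = u \<and> last p = v \<and> distinct p
     \<and> successively (\<lambda>x y. (x, y) \<in> R) p"

definition path_event :: "nat \<Rightarrow> nat \<Rightarrow> nat \<Rightarrow> orientation set" where
  "path_event n u v = {h. \<exists>p. dipath (arcs n h) u p v}"

definition no_path_event :: "nat \<Rightarrow> nat \<Rightarrow> nat \<Rightarrow> orientation set" where
  "no_path_event n u v = - path_event n u v"

definition negatively_correlated :: "'a measure \<Rightarrow> 'a set \<Rightarrow> 'a set \<Rightarrow> bool" where
  "negatively_correlated M A B \<longleftrightarrow> measure M (A \<inter> B) < measure M A * measure M B"

definition positively_correlated :: "'a measure \<Rightarrow> 'a set \<Rightarrow> 'a set \<Rightarrow> bool" where
  "positively_correlated M A B \<longleftrightarrow> measure M (A \<inter> B) > measure M A * measure M B"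

lemma finite_K_edges: "finite (K_edges n)"
  by (rule finite_subset[of _ "Pow {1..n}"]) (auto simp: K_edges_def)

lemma rtrancl_imp_dipath:
  assumes "(u, v) \<in> R\<^sup>*"
  shows "\<exists>p. dipath R u p v"
  using assms
proof (induction rule: converse_rtrancl_induct)
  case base
  have "dipath R v [v] v" by (simp add: dipath_def)
  then show ?case ..
next
  case (step u w)
  then obtain p where p: "dipath R w p v" by blast
  show ?case
  proof (cases "u \<in> set p")
    case True
    then obtain ys zs where "p = ys @ u # zs" by (meson split_list)
    with p have "dipath R u (u # zs) v"
      by (auto simp: dipath_def successively_append_iff)
    then show ?thesis ..
  next
    case False
    with p step.hyps(1) have "dipath R u (u # p) v"
      by (auto simp: dipath_def successively_Cons)
    then show ?thesis ..
  qed
qed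

lemma walk_imp_rtrancl:
  "p \<noteq> [] \<Longrightarrow> successively (\<lambda>x y. (x, y) \<in> R) p \<Longrightarrow> (hd p, last p) \<in> R\<^sup>*"
  by (induction p) (auto simp: successively_Cons intro: converse_rtrancl_into_rtrancl)

lemma ex_dipath_iff_rtrancl: "(\<exists>p. dipath R u p v) \<longleftrightarrow> (u, v) \<in> R\<^sup>*"
  using rtrancl_imp_dipath[of u v R] walk_imp_rtrancl[of _ R] by (auto simp: dipath_def)

end

theory Submission
  imports Defs
begin

text \<open>Let \<open>n = m + 3\<close> and write \<open>Q\<close> for \<open>scaled_miss\<close>. A vertex \<open>x\<close> fails to reach a vertex \<open>y\<close> mostly
because \<open>x\<close> is a sink or \<open>y\<close> is a source, each of probability \<open>1 / 2 ^ (n - 1)\<close>; so it is natural to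
write \<open>P(A) = P(B) = Q (m + 1) / 2 ^ (n - 1)\<close>, and \<open>Q\<close> is close to \<open>2\<close> for large arguments.

If \<open>b\<close> is a source, then \<open>B\<close> holds, and deleting \<open>b\<close> turns \<open>A\<close> into the same event in a
tournament on \<open>n - 1\<close> vertices, of probability \<open>Q m / 2 ^ (n - 2)\<close>. The same is true with \<open>A\<close> and
\<open>B\<close> exchanged if \<open>a\<close> is a sink, and if both happen then so do \<open>A\<close> and \<open>B\<close>. By inclusion and
exclusion, \<open>P(A \<inter> B)\<close> is at least \<open>(4 * Q m - 2) / 2 ^ (2 * n - 2)\<close>
(lemma \<open>tournament_prob_source_or_sink\<close>). All that is left is to compare \<open>(Q (m + 1))\<^sup>2\<close> with
\<open>4 * Q m - 2\<close>. For large \<open>m\<close> these numbers are close to \<open>4\<close> and \<open>6\<close>, which gives the positive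
correlation.

For \<open>n \<le> 4\<close> the lower bound is an equality: the vertices that \<open>s\<close> does not reach and the vertices that
do not reach \<open>s\<close> form two disjoint sets, which avoid \<open>s\<close> and contain \<open>b\<close> and \<open>a\<close> respectively, and
among at most three vertices one of the sets has to be a singleton; a set \<open>{b}\<close> of unreached vertices
makes \<open>b\<close> a source, and dually for \<open>a\<close>. As \<open>Q 0 = 1\<close>, \<open>Q 1 = 3/2\<close> and \<open>Q 2 = 2\<close>, the comparison is
\<open>9/4 > 2\<close> for \<open>n = 3\<close> and \<open>4 = 4\<close> for \<open>n = 4\<close>.

The numbers \<open>Q\<close> come from conditioning on the set \<open>W\<close> of vertices reachable from \<open>x\<close>: all arcs between
\<open>W\<close> and its complement then point into \<open>W\<close>, and \<open>x\<close> reaches all of \<open>W\<close> inside \<open>W\<close>. This expresses \<open>Q\<close>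
through the probabilities \<open>root_prob\<close> that a root reaches every vertex, and also determines the latter
recursively, because the probabilities of all possible \<open>W\<close> add up to \<open>1\<close>.
The probabilities are computed by counting tournaments, represented as relations; the one product
formula that is needed is \<open>tournament_prob_cut\<close>.\<close>

section \<open>Tournaments as relations\<close>

definition tournaments :: "'a set \<Rightarrow> ('a \<times> 'a) set set" where
  "tournaments V = {R. R \<subseteq> V \<times> V \<and> asym R \<and> total_on V R}"

lemma tournamentI:
  assumes "R \<subseteq> V \<times> V" "\<And>u v. (u, v) \<in> R \<Longrightarrow> (v, u) \<notin> R"
    and "\<And>u v. u \<in> V \<Longrightarrow> v \<in> V \<Longrightarrow> u \<noteq> v \<Longrightarrow> (u, v) \<in> R \<or> (v, u) \<in> R"
  shows "R \<in> tournaments V"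
  using assms(1) asymI[OF assms(2)] total_onI[OF assms(3)] by (simp add: tournaments_def)

lemma
  assumes "R \<in> tournaments V"
  shows tournament_subset: "R \<subseteq> V \<times> V"
    and tournament_asym: "(u, v) \<in> R \<Longrightarrow> (v, u) \<notin> R"
    and tournament_total: "u \<in> V \<Longrightarrow> v \<in> V \<Longrightarrow> u \<noteq> v \<Longrightarrow> (u, v) \<in> R \<or> (v, u) \<in> R"
proof -
  have R: "R \<subseteq> V \<times> V" "asym R" "total_on V R"
    using assms by (simp_all add: tournaments_def)
  show "R \<subseteq> V \<times> V" by (rule R(1))
  show "(u, v) \<in> R \<Longrightarrow> (v, u) \<notin> R" by (rule asymD[OF R(2)])
  show "u \<in> V \<Longrightarrow> v \<in> V \<Longrightarrow> u \<noteq> v \<Longrightarrow> (u, v) \<in> R \<or> (v, u) \<in> R"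
    using R(3) unfolding total_on_def by blast
qed

definition tournament_prob :: "'a set \<Rightarrow> (('a \<times> 'a) set \<Rightarrow> bool) \<Rightarrow> real" where
  "tournament_prob V E = card {R \<in> tournaments V. E R} / card (tournaments V)"

definition edges :: "'a set \<Rightarrow> 'a set set" where
  "edges V = {e. e \<subseteq> V \<and> card e = 2}"

definition oriented_arcs :: "'a set \<Rightarrow> ('a set \<Rightarrow> 'a) \<Rightarrow> ('a \<times> 'a) set" where
  "oriented_arcs V h = {(u, v). u \<noteq> v \<and> {u, v} \<in> edges V \<and> h {u, v} = v}"

lemma edge_iff: "{u, v} \<in> edges V \<longleftrightarrow> u \<in> V \<and> v \<in> V \<and> u \<noteq> v"
  by (auto simp: edges_def card_2_iff)

lemma finite_edges: "finite V \<Longrightarrow> finite (edges V)"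
  by (rule finite_subset[of _ "Pow V"]) (auto simp: edges_def)

text \<open>A tournament is the same thing as a choice of a head for every edge, so the product distribution of
the heads becomes the uniform distribution on tournaments. The default value \<open>d\<close> pins down the
heads of sets that are not edges, without which the correspondence would not be injective.\<close>
lemma bij_betw_oriented_arcs:
  "bij_betw (oriented_arcs V) (PiE_dflt (edges V) d (\<lambda>e. e)) (tournaments V)"
proof (rule bij_betwI')
  fix g h
  assume g: "g \<in> PiE_dflt (edges V) d (\<lambda>e. e)" and h: "h \<in> PiE_dflt (edges V) d (\<lambda>e. e)"
  show "oriented_arcs V g = oriented_arcs V h \<longleftrightarrow> g = h"
  proof
    assume eq: "oriented_arcs V g = oriented_arcs V h"
    show "g = h"
    proof
      fix e
      show "g e = h e"
      proof (cases "e \<in> edges V")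
        case True
        then obtain u v where uv: "e = {u, v}" "u \<noteq> v" "u \<in> V" "v \<in> V"
          by (auto simp: edges_def card_2_iff)
        have "g e \<in> {u, v}" "h e \<in> {u, v}"
          using g h True uv by (auto simp: PiE_dflt_def)
        moreover have "(u, v) \<in> oriented_arcs V g \<longleftrightarrow> (u, v) \<in> oriented_arcs V h"
          using eq by simp
        ultimately show ?thesis
          using uv by (auto simp: oriented_arcs_def edge_iff)
      next
        case False
        then show ?thesis using g h by (auto simp: PiE_dflt_def)
      qed
    qed
  qed simp
next
  fix h assume h: "h \<in> PiE_dflt (edges V) d (\<lambda>e. e)"
  have head_in: "h e \<in> e" if "e \<in> edges V" for e
    using h that by (auto simp: PiE_dflt_def)
  have "h {u, v} \<in> {u, v}" if "u \<in> V" "v \<in> V" "u \<noteq> v" for u v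
    by (rule head_in) (simp add: edge_iff that)
  then show "oriented_arcs V h \<in> tournaments V"
    by (intro tournamentI) (fastforce simp: oriented_arcs_def edge_iff insert_commute)+
next
  fix R assume R: "R \<in> tournaments V"
  note R = tournament_subset[OF R] tournament_asym[OF R] tournament_total[OF R]
  \<comment> \<open>The head of \<open>e\<close>, which is unique because \<open>R\<close> is asymmetric.\<close>
  define h where "h e = (if e \<in> edges V then SOME v. \<exists>u. e = {u, v} \<and> (u, v) \<in> R else d)" for e
  have head: "h {u, v} = v" if uv: "(u, v) \<in> R" for u v
  proof -
    have "u \<noteq> v" "u \<in> V" "v \<in> V" using R(1) R(2)[OF uv] uv by auto
    then have "{u, v} \<in> edges V" by (simp add: edge_iff)
    moreover have "(SOME w. \<exists>x. {u, v} = {x, w} \<and> (x, w) \<in> R) = v"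
    proof (rule some_equality)
      show "\<exists>x. {u, v} = {x, v} \<and> (x, v) \<in> R" using uv by blast
      show "w = v" if "\<exists>x. {u, v} = {x, w} \<and> (x, w) \<in> R" for w
        using that R(2)[OF uv] by (auto simp: doubleton_eq_iff)
    qed
    ultimately show ?thesis by (simp add: h_def)
  qed
  have "h e \<in> e" if "e \<in> edges V" for e
  proof -
    from that obtain u v where "e = {u, v}" "u \<noteq> v" "u \<in> V" "v \<in> V"
      by (auto simp: edges_def card_2_iff)
    with R(3)[of u v] head[of u v] head[of v u] show ?thesis
      by (auto simp: insert_commute)
  qed
  then have "h \<in> PiE_dflt (edges V) d (\<lambda>e. e)"
    by (auto simp: PiE_dflt_def h_def)
  moreover have "R = oriented_arcs V h"
  proof -
    have "(u, v) \<in> R \<longleftrightarrow> (u, v) \<in> oriented_arcs V h" for u v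
    proof
      assume uv: "(u, v) \<in> R"
      with R(1) R(2)[OF uv] head[OF uv] show "(u, v) \<in> oriented_arcs V h"
        by (auto simp: oriented_arcs_def edge_iff)
    next
      assume "(u, v) \<in> oriented_arcs V h"
      then show "(u, v) \<in> R"
        using R(3)[of u v] head[of v u] by (auto simp: oriented_arcs_def edge_iff insert_commute)
    qed
    then show ?thesis by auto
  qed
  ultimately show "\<exists>h\<in>PiE_dflt (edges V) d (\<lambda>e. e). R = oriented_arcs V h" by blast
qed

lemma card_tournaments: "finite V \<Longrightarrow> card (tournaments V) = 2 ^ (card V choose 2)"
proof -
  assume "finite V"
  have "card (tournaments V) = card (PiE_dflt (edges V) undefined (\<lambda>e. e))"
    using bij_betw_same_card[OF bij_betw_oriented_arcs] by metis
  also have "\<dots> = (\<Prod>e\<in>edges V. card e)"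
    by (rule card_PiE_dflt[OF finite_edges[OF \<open>finite V\<close>]])
       (auto simp: edges_def intro: card_ge_0_finite)
  also have "\<dots> = 2 ^ card (edges V)"
    by (simp add: edges_def)
  also have "card (edges V) = card V choose 2"
    unfolding edges_def by (rule n_subsets[OF \<open>finite V\<close>])
  finally show ?thesis .
qed

lemma finite_tournaments: "finite V \<Longrightarrow> finite (tournaments V)"
  using card_tournaments[of V] by (intro card_ge_0_finite) simp

lemma prob_random_orientation:
  "measure_pmf.prob (random_orientation n) {h. E (arcs n h)} = tournament_prob {1..n} E"
proof -
  let ?H = "PiE_dflt (edges {1..n}) 0 (\<lambda>e. e)"
  have arcs: "arcs n = oriented_arcs {1..n}" and K: "K_edges n = edges {1..n}"
    by (auto simp: arcs_def oriented_arcs_def edges_def K_edges_def fun_eq_iff)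
  have fin: "finite e" "e \<noteq> {}" if "e \<in> edges {1..n}" for e
    using that by (auto simp: edges_def intro: card_ge_0_finite)
  have "random_orientation n = pmf_of_set ?H"
    unfolding random_orientation_def K using fin
    by (subst Pi_pmf_of_set) (auto simp: finite_edges)
  moreover have "finite ?H" "?H \<noteq> {}"
    using fin by (auto simp: finite_edges)
  ultimately have "map_pmf (arcs n) (random_orientation n) = pmf_of_set (tournaments {1..n})"
    unfolding arcs using map_pmf_of_set_bij_betw[OF bij_betw_oriented_arcs] by metis
  then have "measure_pmf.prob (random_orientation n) (arcs n -` Collect E)
      = measure_pmf.prob (pmf_of_set (tournaments {1..n})) (Collect E)"
    by (metis measure_map_pmf)
  also have "\<dots> = tournament_prob {1..n} E"
  proof -
    have "tournaments {1..n} \<noteq> {}"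
      using card_tournaments[of "{1..n}"] by force
    moreover have "tournaments {1..n} \<inter> Collect E = {R \<in> tournaments {1..n}. E R}" by auto
    ultimately show ?thesis
      by (simp add: measure_pmf_of_set finite_tournaments tournament_prob_def)
  qed
  finally show ?thesis by (simp add: vimage_def)
qed

lemma tournament_prob_cong:
  "(\<And>R. R \<in> tournaments V \<Longrightarrow> E R \<longleftrightarrow> F R) \<Longrightarrow> tournament_prob V E = tournament_prob V F"
  by (auto simp: tournament_prob_def intro!: arg_cong[where f = card])

lemma tournament_prob_True: "finite V \<Longrightarrow> tournament_prob V (\<lambda>R. True) = 1"
  by (simp add: tournament_prob_def card_tournaments)

lemma tournament_prob_mono:
  assumes "finite V" "\<And>R. R \<in> tournaments V \<Longrightarrow> E R \<Longrightarrow> F R"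
  shows "tournament_prob V E \<le> tournament_prob V F"
  unfolding tournament_prob_def using assms
  by (intro divide_right_mono of_nat_mono card_mono) (auto simp: finite_tournaments)

lemma tournament_prob_disj:
  assumes "finite V"
  shows "tournament_prob V (\<lambda>R. E R \<or> F R)
    = tournament_prob V E + tournament_prob V F - tournament_prob V (\<lambda>R. E R \<and> F R)"
proof -
  let ?E = "{R \<in> tournaments V. E R}" and ?F = "{R \<in> tournaments V. F R}"
  have "card ?E + card ?F = card (?E \<union> ?F) + card (?E \<inter> ?F)"
    by (rule card_Un_Int) (auto simp: finite_tournaments assms)
  moreover have "?E \<union> ?F = {R \<in> tournaments V. E R \<or> F R}"
    "?E \<inter> ?F = {R \<in> tournaments V. E R \<and> F R}" by auto
  ultimately have "card ?E + card ?F
      = card {R \<in> tournaments V. E R \<or> F R} + card {R \<in> tournaments V. E R \<and> F R}"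
    by (simp only:)
  then have "real (card ?E) + card ?F
      = card {R \<in> tournaments V. E R \<or> F R} + card {R \<in> tournaments V. E R \<and> F R}"
    by (simp only: flip: of_nat_add)
  then show ?thesis
    by (simp add: tournament_prob_def flip: add_divide_distrib diff_divide_distrib)
qed

lemma tournament_prob_partition:
  assumes "finite V" "finite I" "\<And>R. R \<in> tournaments V \<Longrightarrow> E R \<longleftrightarrow> f R \<in> I"
  shows "tournament_prob V E = (\<Sum>i\<in>I. tournament_prob V (\<lambda>R. f R = i))"
proof -
  have "{R \<in> tournaments V. E R} = (\<Union>i\<in>I. {R \<in> tournaments V. f R = i})"
    using assms(3) by auto
  also have "card \<dots> = (\<Sum>i\<in>I. card {R \<in> tournaments V. f R = i})"
    using assms by (intro card_UN_disjoint) (auto simp: finite_tournaments)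
  finally show ?thesis
    by (simp add: tournament_prob_def sum_divide_distrib)
qed

lemma tournament_prob_le_1: "finite V \<Longrightarrow> tournament_prob V E \<le> 1"
  using tournament_prob_mono[of V E "\<lambda>_. True"] by (simp add: tournament_prob_True)

section \<open>Directed cuts\<close>

definition induced :: "('a \<times> 'a) set \<Rightarrow> 'a set \<Rightarrow> ('a \<times> 'a) set" where
  "induced R U = R \<inter> U \<times> U"

lemma induced_tournament:
  assumes "R \<in> tournaments V" "U \<subseteq> V"
  shows "induced R U \<in> tournaments U"
proof (rule tournamentI)
  show "(v, u) \<notin> induced R U" if "(u, v) \<in> induced R U" for u v
    using that tournament_asym[OF assms(1), of u v] by (simp add: induced_def)
  show "(u, v) \<in> induced R U \<or> (v, u) \<in> induced R U" if "u \<in> U" "v \<in> U" "u \<noteq> v" for u v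
    using that assms(2) tournament_total[OF assms(1), of u v] by (auto simp: induced_def)
qed (auto simp: induced_def)

lemma cut_no_back_arc:
  "R \<in> tournaments V \<Longrightarrow> U \<times> W \<subseteq> R \<Longrightarrow> w \<in> W \<Longrightarrow> u \<in> U \<Longrightarrow> (w, u) \<notin> R"
  using tournament_asym[of R V u w] by blast

lemma choose_two_add: "(k + l) choose 2 = (k choose 2) + (l choose 2) + k * l"
proof (induction k)
  case (Suc k)
  have "Suc i choose 2 = i + (i choose 2)" for i by (simp add: numeral_2_eq_2)
  with Suc show ?case by simp
qed simp

text \<open>The arcs inside \<open>U\<close>, the arcs inside \<open>W\<close> and the arcs between them are independent; when all the latter
point from \<open>U\<close> to \<open>W\<close>, a tournament is just a pair of tournaments on the two parts.\<close>
lemma tournament_prob_cut: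
  assumes "finite U" "finite W" "U \<inter> W = {}"
  shows "tournament_prob (U \<union> W) (\<lambda>R. U \<times> W \<subseteq> R \<and> E (induced R U) \<and> F (induced R W))
    = tournament_prob U E * tournament_prob W F / 2 ^ (card U * card W)"
proof -
  let ?L = "{R \<in> tournaments (U \<union> W). U \<times> W \<subseteq> R \<and> E (induced R U) \<and> F (induced R W)}"
  let ?EU = "{R \<in> tournaments U. E R}" and ?FW = "{R \<in> tournaments W. F R}"
  let ?join = "\<lambda>(S, T). S \<union> T \<union> U \<times> W" and ?split = "\<lambda>R. (induced R U, induced R W)"
  have induced_join: "induced (S \<union> T \<union> U \<times> W) U = S" "induced (S \<union> T \<union> U \<times> W) W = T"
    if "S \<in> tournaments U" "T \<in> tournaments W" for S T
    using tournament_subset[OF that(1)] tournament_subset[OF that(2)] assms(3)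
    by (auto simp: induced_def)
  have "bij_betw ?split ?L (?EU \<times> ?FW)"
  proof (rule bij_betw_byWitness[where f' = ?join])
    show "\<forall>R\<in>?L. ?join (?split R) = R"
    proof
      fix R assume "R \<in> ?L"
      then have R: "R \<in> tournaments (U \<union> W)" "U \<times> W \<subseteq> R" by auto
      have "R \<inter> W \<times> U = {}"
        using cut_no_back_arc[OF R] by auto
      then show "?join (?split R) = R"
        using R(2) tournament_subset[OF R(1)] by (auto simp: induced_def)
    qed
    show "\<forall>p\<in>?EU \<times> ?FW. ?split (?join p) = p"
      using induced_join by auto
    show "?split ` ?L \<subseteq> ?EU \<times> ?FW"
      by (auto intro: induced_tournament)
    have "S \<union> T \<union> U \<times> W \<in> tournaments (U \<union> W)"
      if "S \<in> tournaments U" "T \<in> tournaments W" for S T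
    proof -
      note S = tournament_subset[OF that(1)] tournament_asym[OF that(1)] tournament_total[OF that(1)]
      note T = tournament_subset[OF that(2)] tournament_asym[OF that(2)] tournament_total[OF that(2)]
      show ?thesis
      proof (rule tournamentI)
        show "S \<union> T \<union> U \<times> W \<subseteq> (U \<union> W) \<times> (U \<union> W)"
          using S(1) T(1) by blast
        show "(v, u) \<notin> S \<union> T \<union> U \<times> W" if "(u, v) \<in> S \<union> T \<union> U \<times> W" for u v
          using that S(1,2) T(1,2) assms(3) by blast
        show "(u, v) \<in> S \<union> T \<union> U \<times> W \<or> (v, u) \<in> S \<union> T \<union> U \<times> W"
          if "u \<in> U \<union> W" "v \<in> U \<union> W" "u \<noteq> v" for u v
          using that S(3)[of u v] T(3)[of u v] by blast
      qed
    qed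
    then show "?join ` (?EU \<times> ?FW) \<subseteq> ?L"
      using induced_join by auto
  qed
  then have "card ?L = card ?EU * card ?FW"
    using card_cartesian_product[of ?EU ?FW] by (simp only: bij_betw_same_card)
  moreover have "card (tournaments (U \<union> W))
      = card (tournaments U) * card (tournaments W) * 2 ^ (card U * card W)"
    using assms by (simp add: card_tournaments card_Un_disjoint choose_two_add power_add)
  ultimately show ?thesis
    by (simp add: tournament_prob_def)
qed

lemma induced_reach_imp_reach: "(x, y) \<in> (induced R U)\<^sup>* \<Longrightarrow> (x, y) \<in> R\<^sup>*"
  by (erule subsetD[OF rtrancl_mono, rotated]) (simp add: induced_def)

text \<open>A path that starts below a cut can never climb back above it, so it only uses arcs below the cut.\<close>
lemma reach_from_lower:
  assumes "R \<in> tournaments (U \<union> W)" "U \<times> W \<subseteq> R" "x \<in> W"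
  shows "(x, y) \<in> R\<^sup>* \<longleftrightarrow> (x, y) \<in> (induced R W)\<^sup>*"
proof
  assume "(x, y) \<in> R\<^sup>*"
  then have "(x, y) \<in> (induced R W)\<^sup>* \<and> y \<in> W"
  proof (induction rule: rtrancl_induct)
    case base
    then show ?case using assms(3) by simp
  next
    case (step y z)
    then have "y \<in> W" "(x, y) \<in> (induced R W)\<^sup>*" by simp_all
    moreover have "z \<in> W"
      using tournament_subset[OF assms(1)] cut_no_back_arc[OF assms(1,2)] \<open>y \<in> W\<close> step.hyps(2)
      by blast
    moreover have "(y, z) \<in> induced R W"
      using step.hyps(2) \<open>y \<in> W\<close> \<open>z \<in> W\<close> by (simp add: induced_def)
    ultimately show ?case by (simp add: rtrancl.rtrancl_into_rtrancl)
  qed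
  then show "(x, y) \<in> (induced R W)\<^sup>*" ..
qed (rule induced_reach_imp_reach)

text \<open>Dually, a path that ends above a cut has never left the upper part.\<close>
lemma reach_to_upper:
  assumes "R \<in> tournaments (U \<union> W)" "U \<times> W \<subseteq> R" "y \<in> U"
  shows "(x, y) \<in> R\<^sup>* \<longleftrightarrow> (x, y) \<in> (induced R U)\<^sup>*"
proof
  assume "(x, y) \<in> R\<^sup>*"
  then have "(x, y) \<in> (induced R U)\<^sup>* \<and> x \<in> U"
  proof (induction rule: converse_rtrancl_induct)
    case base
    then show ?case using assms(3) by simp
  next
    case (step w x)
    then have "x \<in> U" "(x, y) \<in> (induced R U)\<^sup>*" by simp_all
    moreover have "w \<in> U"
      using tournament_subset[OF assms(1)] cut_no_back_arc[OF assms(1,2)] \<open>x \<in> U\<close> step.hyps(1)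
      by blast
    moreover have "(w, x) \<in> induced R U"
      using step.hyps(1) \<open>x \<in> U\<close> \<open>w \<in> U\<close> by (simp add: induced_def)
    ultimately show ?case by (simp add: converse_rtrancl_into_rtrancl)
  qed
  then show "(x, y) \<in> (induced R U)\<^sup>*" ..
qed (rule induced_reach_imp_reach)

text \<open>No arc leaves the set of vertices reachable from \<open>s\<close>, and in a tournament this means that every vertex
outside has arcs to all vertices inside. The event thereby splits into an event about the arcs across
the cut and an event about the arcs inside \<open>W\<close>, as \<open>tournament_prob_cut\<close> requires.\<close>
lemma reach_set_iff_cut:
  assumes "R \<in> tournaments V" "s \<in> W" "W \<subseteq> V"
  shows "R\<^sup>* `` {s} = W \<longleftrightarrow> (V - W) \<times> W \<subseteq> R \<and> (induced R W)\<^sup>* `` {s} = W"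
proof -
  have "(V - W) \<union> W = V" using assms(3) by blast
  then have R: "R \<in> tournaments ((V - W) \<union> W)" using assms(1) by (simp only:)
  have "R\<^sup>* `` {s} = (induced R W)\<^sup>* `` {s}" if "(V - W) \<times> W \<subseteq> R"
    using reach_from_lower[OF R that assms(2)] by blast
  moreover have "(V - W) \<times> W \<subseteq> R" if reach: "R\<^sup>* `` {s} = W"
  proof clarify
    fix u w assume uw: "u \<in> V" "u \<notin> W" "w \<in> W"
    have "(s, w) \<in> R\<^sup>*" "(s, u) \<notin> R\<^sup>*" using reach uw by auto
    then have "(w, u) \<notin> R" using rtrancl.rtrancl_into_rtrancl[of s w R u] by blast
    then show "(u, w) \<in> R"
      using tournament_total[OF assms(1), of u w] uw assms(3) by auto
  qed
  ultimately show ?thesis by metis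
qed

lemma tournament_prob_reach_set:
  assumes "finite V" "s \<in> W" "W \<subseteq> V"
  shows "tournament_prob V (\<lambda>R. R\<^sup>* `` {s} = W)
    = tournament_prob W (\<lambda>R. R\<^sup>* `` {s} = W) / 2 ^ (card W * card (V - W))"
proof -
  have V: "(V - W) \<union> W = V" using assms(3) by blast
  have "finite W" using assms finite_subset by blast
  have "tournament_prob V (\<lambda>R. R\<^sup>* `` {s} = W)
      = tournament_prob ((V - W) \<union> W)
          (\<lambda>R. (V - W) \<times> W \<subseteq> R \<and> True \<and> (induced R W)\<^sup>* `` {s} = W)"
    unfolding V using reach_set_iff_cut[OF _ assms(2,3)] by (intro tournament_prob_cong) auto
  also have "\<dots> = tournament_prob W (\<lambda>R. R\<^sup>* `` {s} = W) / 2 ^ (card (V - W) * card W)"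
    using \<open>finite W\<close> assms(1) tournament_prob_True[of "V - W"]
    by (subst tournament_prob_cut[where E = "\<lambda>_. True"]) auto
  finally show ?thesis by (simp add: mult.commute)
qed

section \<open>The probability of missing one vertex\<close>

text \<open>The probability that a fixed root reaches all of \<open>m\<close> other vertices, by subtracting the cases in which
it reaches exactly \<open>k < m\<close> of them: then \<open>k + 1\<close> vertices lie below a cut with \<open>m - k\<close> vertices
above it.\<close>
fun root_prob :: "nat \<Rightarrow> real" where
  "root_prob m = 1 - (\<Sum>k<m. real (m choose k) * root_prob k / 2 ^ ((k + 1) * (m - k)))"

declare root_prob.simps [simp del]

text \<open>The probability, multiplied by \<open>2 ^ (m + 1)\<close>, that \<open>x\<close> does not reach \<open>y\<close> when there are \<open>m\<close> further
vertices; \<open>k\<close> is the number of those that \<open>x\<close> does reach. The exponent \<open>(k + 1) * (m + 1 - k)\<close> of the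
cut equals \<open>k * (m - k) + (m + 1)\<close>, so that the scaling leaves a formula that is symmetric in the
two sides of the cut.\<close>
definition scaled_miss :: "nat \<Rightarrow> real" where
  "scaled_miss m = (\<Sum>k\<le>m. real (m choose k) * root_prob k / 2 ^ (k * (m - k)))"

lemma sum_Pow_by_card:
  fixes g :: "nat \<Rightarrow> real"
  assumes "finite A"
  shows "(\<Sum>X\<in>Pow A. g (card X)) = (\<Sum>k\<le>card A. real (card A choose k) * g k)"
proof -
  have "(\<Sum>X\<in>Pow A. g (card X)) = (\<Sum>k\<le>card A. \<Sum>X\<in>{X \<in> Pow A. card X = k}. g (card X))"
    using assms by (intro sum.group[symmetric]) (auto simp: card_mono)
  also have "\<dots> = (\<Sum>k\<le>card A. real (card A choose k) * g k)"
    using n_subsets[OF assms] by (intro sum.cong) auto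
  finally show ?thesis .
qed
lemma reach_subset:
  assumes "R \<in> tournaments V" "s \<in> V"
  shows "R\<^sup>* `` {s} \<subseteq> V"
proof
  fix x assume "x \<in> R\<^sup>* `` {s}"
  then have "(s, x) \<in> R\<^sup>*" by simp
  then show "x \<in> V"
    using assms(2) tournament_subset[OF assms(1)] by (induction rule: rtrancl_induct) auto
qed

text \<open>Total probability over the reachable set \<open>insert s X\<close>. Taking all other vertices for \<open>A\<close> makes the left
side \<open>1\<close> and yields the recursion for \<open>root_prob\<close>; leaving out one vertex \<open>y\<close> gives the probability
that \<open>s\<close> does not reach \<open>y\<close>.\<close>
lemma tournament_prob_reach_within:
  assumes "finite V" "s \<in> V" "A \<subseteq> V - {s}"
  shows "tournament_prob V (\<lambda>R. R\<^sup>* `` {s} \<subseteq> insert s A)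
    = (\<Sum>X\<in>Pow A. tournament_prob (insert s X) (\<lambda>R. R\<^sup>* `` {s} = insert s X)
        / 2 ^ ((card X + 1) * (card V - 1 - card X)))"
proof -
  have inj: "inj_on (insert s) (Pow A)"
    using assms(3) by (intro inj_onI) (metis Diff_iff PowD insert_ident singletonI subsetD)
  have "finite A" using assms finite_subset by blast
  have "tournament_prob V (\<lambda>R. R\<^sup>* `` {s} \<subseteq> insert s A)
      = (\<Sum>W\<in>insert s ` Pow A. tournament_prob V (\<lambda>R. R\<^sup>* `` {s} = W))"
  proof (rule tournament_prob_partition)
    fix R :: "('a \<times> 'a) set"
    let ?W = "R\<^sup>* `` {s}"
    have "?W = insert s (?W - {s})" by auto
    then show "?W \<subseteq> insert s A \<longleftrightarrow> ?W \<in> insert s ` Pow A" by blast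
  qed (use assms \<open>finite A\<close> in auto)
  also have "\<dots> = (\<Sum>X\<in>Pow A. tournament_prob V (\<lambda>R. R\<^sup>* `` {s} = insert s X))"
    using inj by (simp add: sum.reindex)
  also have "\<dots> = (\<Sum>X\<in>Pow A. tournament_prob (insert s X) (\<lambda>R. R\<^sup>* `` {s} = insert s X)
        / 2 ^ ((card X + 1) * (card V - 1 - card X)))"
  proof (rule sum.cong)
    fix X assume "X \<in> Pow A"
    then have X: "insert s X \<subseteq> V" "s \<notin> X" "finite X"
      using assms finite_subset[OF _ \<open>finite A\<close>] by auto
    then have "card (insert s X) = card X + 1" "card (V - insert s X) = card V - 1 - card X"
      by (simp_all add: card_Diff_subset)
    then show "tournament_prob V (\<lambda>R. R\<^sup>* `` {s} = insert s X)
      = tournament_prob (insert s X) (\<lambda>R. R\<^sup>* `` {s} = insert s X)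
        / 2 ^ ((card X + 1) * (card V - 1 - card X))"
      using tournament_prob_reach_set[OF assms(1) _ X(1), of s] by simp
  qed simp
  finally show ?thesis .
qed

text \<open>The sum over reachable sets is \<open>1\<close>, and so is the corresponding sum with \<open>root_prob\<close>, by its recursion.
By induction the two agree in every summand except the one for the full vertex set, hence in that
one too.\<close>
lemma tournament_prob_reach_all:
  assumes "finite A" "s \<notin> A"
  shows "tournament_prob (insert s A) (\<lambda>R. R\<^sup>* `` {s} = insert s A) = root_prob (card A)"
  using assms
proof (induction A rule: finite_psubset_induct)
  case (psubset A)
  define m where "m = card A"
  define g where "g k = root_prob k / 2 ^ ((k + 1) * (m - k))" for k
  define h where "h X = tournament_prob (insert s X) (\<lambda>R. R\<^sup>* `` {s} = insert s X)
      / 2 ^ ((card X + 1) * (m - card X))" for X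
  have "tournament_prob (insert s A) (\<lambda>R. R\<^sup>* `` {s} \<subseteq> insert s A) = 1"
    using reach_subset[of _ "insert s A" s] tournament_prob_True[of "insert s A"] psubset.hyps
    by (subst tournament_prob_cong[where F = "\<lambda>_. True"]) auto
  then have "1 = (\<Sum>X\<in>Pow A. h X)"
    using tournament_prob_reach_within[of "insert s A" s A] psubset.hyps psubset.prems
    by (simp add: h_def m_def)
  also have "\<dots> = h A + (\<Sum>X\<in>Pow A - {A}. h X)"
    using psubset.hyps by (intro sum.remove) auto
  also have "(\<Sum>X\<in>Pow A - {A}. h X) = (\<Sum>X\<in>Pow A - {A}. g (card X))"
  proof (rule sum.cong)
    fix X assume "X \<in> Pow A - {A}"
    then have "X \<subset> A" "s \<notin> X" using psubset.prems by auto
    then show "h X = g (card X)"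
      using psubset.IH[of X] by (simp add: g_def h_def)
  qed simp
  finally have "1 = h A + (\<Sum>X\<in>Pow A - {A}. g (card X))" .
  moreover have "1 = g m + (\<Sum>X\<in>Pow A - {A}. g (card X))"
  proof -
    have "{..m} = insert m {..<m}" by auto
    then have "1 = (\<Sum>k\<le>m. real (m choose k) * g k)"
      by (simp add: g_def) (subst root_prob.simps, simp)
    also have "\<dots> = (\<Sum>X\<in>Pow A. g (card X))"
      using sum_Pow_by_card[OF psubset.hyps(1), of g] by (simp add: m_def)
    also have "\<dots> = g m + (\<Sum>X\<in>Pow A - {A}. g (card X))"
      unfolding m_def using psubset.hyps by (intro sum.remove) auto
    finally show ?thesis .
  qed
  \<comment> \<open>For the full set the denominators are \<open>1\<close>, so this is the claim itself.\<close>
  ultimately have "h A = g m" by linarith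
  then show ?case by (simp add: h_def g_def m_def)
qed

text \<open>The bounds are not visible in the recursion, but they hold because \<open>root_prob\<close> is a probability; any
concrete vertex set of the right size serves as a witness.\<close>
lemma root_prob_nonneg: "0 \<le> root_prob m" and root_prob_le_1: "root_prob m \<le> 1"
proof -
  have "root_prob m = tournament_prob (insert m {..<m}) (\<lambda>R. R\<^sup>* `` {m} = insert m {..<m})"
    using tournament_prob_reach_all[of "{..<m}" m] by simp
  then show "0 \<le> root_prob m" "root_prob m \<le> 1"
    using tournament_prob_le_1[of "insert m {..<m}"] by (simp_all add: tournament_prob_def)
qed

lemma tournament_prob_miss:
  assumes "card V = m + 2" "x \<in> V" "y \<in> V" "x \<noteq> y"
  shows "tournament_prob V (\<lambda>R. (x, y) \<notin> R\<^sup>*) = scaled_miss m / 2 ^ (m + 1)"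
proof -
  let ?A = "V - {x, y}"
  have "finite V" using assms(1) by (intro card_ge_0_finite) simp
  have "card ?A = m" using assms \<open>finite V\<close> by (simp add: card_Diff_subset)
  have iff: "(x, y) \<notin> R\<^sup>* \<longleftrightarrow> R\<^sup>* `` {x} \<subseteq> insert x ?A" if "R \<in> tournaments V" for R
    using reach_subset[OF that \<open>x \<in> V\<close>] \<open>x \<noteq> y\<close> by auto
  have "tournament_prob V (\<lambda>R. (x, y) \<notin> R\<^sup>*)
      = (\<Sum>X\<in>Pow ?A. tournament_prob (insert x X) (\<lambda>R. R\<^sup>* `` {x} = insert x X)
          / 2 ^ ((card X + 1) * (card V - 1 - card X)))"
    using tournament_prob_reach_within[OF \<open>finite V\<close> \<open>x \<in> V\<close>, of ?A] iff
    by (subst tournament_prob_cong[OF iff]) auto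
  also have "\<dots> = (\<Sum>X\<in>Pow ?A. root_prob (card X) / 2 ^ ((card X + 1) * (m + 1 - card X)))"
  proof (rule sum.cong)
    fix X assume "X \<in> Pow ?A"
    then have "finite X" "x \<notin> X" using \<open>finite V\<close> finite_subset[of X V] by auto
    then show "tournament_prob (insert x X) (\<lambda>R. R\<^sup>* `` {x} = insert x X)
          / 2 ^ ((card X + 1) * (card V - 1 - card X))
        = root_prob (card X) / 2 ^ ((card X + 1) * (m + 1 - card X))"
      using tournament_prob_reach_all assms(1) by simp
  qed simp
  also have "\<dots> = (\<Sum>k\<le>m. real (m choose k) * (root_prob k / 2 ^ ((k + 1) * (m + 1 - k))))"
    using sum_Pow_by_card[of ?A "\<lambda>k. root_prob k / 2 ^ ((k + 1) * (m + 1 - k))"]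
      \<open>finite V\<close> \<open>card ?A = m\<close> by simp
  also have "\<dots> = scaled_miss m / 2 ^ (m + 1)"
    unfolding scaled_miss_def sum_divide_distrib
  proof (rule sum.cong)
    fix k assume "k \<in> {..m}"
    then obtain j where "m = k + j" by (auto simp: le_iff_add)
    then have "(k + 1) * (m + 1 - k) = k * (m - k) + (m + 1)" by (simp add: algebra_simps)
    then show "real (m choose k) * (root_prob k / 2 ^ ((k + 1) * (m + 1 - k)))
        = real (m choose k) * root_prob k / 2 ^ (k * (m - k)) / 2 ^ (m + 1)"
      by (simp add: power_add)
  qed simp
  finally show ?thesis .
qed

section \<open>A source or a sink\<close>

definition is_source :: "'a set \<Rightarrow> ('a \<times> 'a) set \<Rightarrow> 'a \<Rightarrow> bool" where
  "is_source V R b \<longleftrightarrow> {b} \<times> (V - {b}) \<subseteq> R"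

definition is_sink :: "'a set \<Rightarrow> ('a \<times> 'a) set \<Rightarrow> 'a \<Rightarrow> bool" where
  "is_sink V R a \<longleftrightarrow> (V - {a}) \<times> {a} \<subseteq> R"

lemma tournament_prob_source:
  assumes "finite V" "b \<in> V"
  shows "tournament_prob V (\<lambda>R. is_source V R b \<and> F (induced R (V - {b})))
    = tournament_prob (V - {b}) F / 2 ^ (card V - 1)"
proof -
  have V: "{b} \<union> (V - {b}) = V" using assms(2) by blast
  have "tournament_prob ({b} \<union> (V - {b}))
      (\<lambda>R. {b} \<times> (V - {b}) \<subseteq> R \<and> True \<and> F (induced R (V - {b})))
    = tournament_prob {b} (\<lambda>_. True) * tournament_prob (V - {b}) F / 2 ^ (card {b} * card (V - {b}))"
    using assms(1) by (intro tournament_prob_cut[where E = "\<lambda>_. True"]) auto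
  then show ?thesis
    unfolding V is_source_def using assms by (simp add: tournament_prob_True)
qed

lemma tournament_prob_sink:
  assumes "finite V" "a \<in> V"
  shows "tournament_prob V (\<lambda>R. is_sink V R a \<and> E (induced R (V - {a})))
    = tournament_prob (V - {a}) E / 2 ^ (card V - 1)"
proof -
  have V: "(V - {a}) \<union> {a} = V" using assms(2) by blast
  have "tournament_prob ((V - {a}) \<union> {a})
      (\<lambda>R. (V - {a}) \<times> {a} \<subseteq> R \<and> E (induced R (V - {a})) \<and> True)
    = tournament_prob (V - {a}) E * tournament_prob {a} (\<lambda>_. True) / 2 ^ (card (V - {a}) * card {a})"
    using assms(1) by (intro tournament_prob_cut[where F = "\<lambda>_. True"]) auto
  then show ?thesis
    unfolding V is_sink_def using assms by (simp add: tournament_prob_True)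
qed

lemma source_reach_iff:
  assumes "R \<in> tournaments V" "b \<in> V" "is_source V R b" "x \<in> V" "x \<noteq> b"
  shows "(x, y) \<in> R\<^sup>* \<longleftrightarrow> (x, y) \<in> (induced R (V - {b}))\<^sup>*"
proof (rule reach_from_lower)
  have "{b} \<union> (V - {b}) = V" using assms(2) by blast
  then show "R \<in> tournaments ({b} \<union> (V - {b}))" using assms(1) by (simp only:)
qed (use assms in \<open>auto simp: is_source_def\<close>)

lemma sink_reach_iff:
  assumes "R \<in> tournaments V" "a \<in> V" "is_sink V R a" "y \<in> V" "y \<noteq> a"
  shows "(x, y) \<in> R\<^sup>* \<longleftrightarrow> (x, y) \<in> (induced R (V - {a}))\<^sup>*"
proof (rule reach_to_upper)
  have "(V - {a}) \<union> {a} = V" using assms(2) by blast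
  then show "R \<in> tournaments ((V - {a}) \<union> {a})" using assms(1) by (simp only:)
qed (use assms in \<open>auto simp: is_sink_def\<close>)

lemma source_unreachable:
  assumes "R \<in> tournaments V" "b \<in> V" "is_source V R b" "x \<in> V" "x \<noteq> b"
  shows "(x, b) \<notin> R\<^sup>*"
proof
  assume "(x, b) \<in> R\<^sup>*"
  then have "(x, b) \<in> (induced R (V - {b}))\<^sup>*"
    using source_reach_iff[OF assms] by blast
  then show False
    using \<open>x \<noteq> b\<close> by (cases rule: rtranclE) (auto simp: induced_def)
qed

lemma sink_reaches_nothing:
  assumes "R \<in> tournaments V" "a \<in> V" "is_sink V R a" "y \<in> V" "y \<noteq> a"
  shows "(a, y) \<notin> R\<^sup>*"
proof
  assume "(a, y) \<in> R\<^sup>*"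
  then have "(a, y) \<in> (induced R (V - {a}))\<^sup>*"
    using sink_reach_iff[OF assms] by blast
  then show False
    using \<open>y \<noteq> a\<close> by (cases rule: converse_rtranclE) (auto simp: induced_def)
qed

text \<open>The sets \<open>X\<close> of vertices missed by \<open>s\<close> and \<open>Y\<close> of vertices missing \<open>s\<close> are disjoint, because \<open>s\<close> is joined
to every other vertex by an arc in one direction. With at most three vertices besides \<open>s\<close> one of
them is a singleton. If \<open>X = {b}\<close>, an arc into \<open>b\<close> would come from a vertex reached by \<open>s\<close> and make
\<open>b\<close> reachable, so \<open>b\<close> is a source.\<close>
lemma source_or_sink_if_both_miss:
  assumes "R \<in> tournaments V" "finite V" "card V \<le> 4" "a \<in> V" "s \<in> V" "b \<in> V"
    and "(a, s) \<notin> R\<^sup>*" "(s, b) \<notin> R\<^sup>*"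
  shows "is_source V R b \<or> is_sink V R a"
proof -
  define X where "X = {v \<in> V. (s, v) \<notin> R\<^sup>*}"
  define Y where "Y = {v \<in> V. (v, s) \<notin> R\<^sup>*}"
  have XY: "b \<in> X" "a \<in> Y" "s \<notin> X" "s \<notin> Y" "finite X" "finite Y"
    using assms by (auto simp: X_def Y_def)
  have "X \<inter> Y = {}"
  proof -
    have "(s, v) \<in> R \<or> (v, s) \<in> R" if "v \<in> V" "v \<noteq> s" for v
      using tournament_total[OF assms(1) \<open>s \<in> V\<close> that(1)] that(2) by blast
    then show ?thesis using XY by (fastforce simp: X_def Y_def)
  qed
  have "card (insert s (X \<union> Y)) \<le> card V"
    using assms by (intro card_mono) (auto simp: X_def Y_def)
  then have "card X + card Y \<le> 3"
    using XY \<open>X \<inter> Y = {}\<close> assms(3) by (simp add: card_Un_disjoint)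
  moreover have "1 \<le> card X" "1 \<le> card Y"
    using XY by (auto simp: Suc_le_eq card_gt_0_iff)
  ultimately have "card X = 1 \<or> card Y = 1" by linarith
  then show ?thesis
  proof
    assume "card X = 1"
    then have "X = {b}" using XY(1) by (auto simp: card_1_singleton_iff)
    have "(b, v) \<in> R" if v: "v \<in> V" "v \<noteq> b" for v
    proof -
      have "(s, v) \<in> R\<^sup>*" using v \<open>X = {b}\<close> by (auto simp: X_def)
      then have "(v, b) \<notin> R"
        using assms(8) rtrancl.rtrancl_into_rtrancl[of s v R b] by blast
      then show ?thesis using tournament_total[OF assms(1) v(1) assms(6) v(2)] by blast
    qed
    then show ?thesis by (auto simp: is_source_def)
  next
    assume "card Y = 1"
    then have "Y = {a}" using XY(2) by (auto simp: card_1_singleton_iff)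
    have "(v, a) \<in> R" if v: "v \<in> V" "v \<noteq> a" for v
    proof -
      have "(v, s) \<in> R\<^sup>*" using v \<open>Y = {a}\<close> by (auto simp: Y_def)
      then have "(a, v) \<notin> R"
        using assms(7) converse_rtrancl_into_rtrancl[of a v R s] by blast
      then show ?thesis using tournament_total[OF assms(1) v(1) assms(4) v(2)] by blast
    qed
    then show ?thesis by (auto simp: is_sink_def)
  qed
qed

text \<open>Deleting the source \<open>b\<close> (or the sink \<open>a\<close>) leaves a tournament on \<open>m + 2\<close> vertices and one of the two
events. The two cases overlap exactly when \<open>b\<close> is a source and \<open>a\<close> is a sink, since the remaining
conditions are then automatic; this accounts for the subtracted \<open>1\<close>.\<close>
lemma tournament_prob_source_or_sink:
  assumes "card V = m + 3" "a \<in> V" "s \<in> V" "b \<in> V" and "a \<noteq> s" "s \<noteq> b" "a \<noteq> b"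
  shows "tournament_prob V (\<lambda>R. (is_source V R b \<or> is_sink V R a) \<and> (a, s) \<notin> R\<^sup>* \<and> (s, b) \<notin> R\<^sup>*)
    = (2 * scaled_miss m - 1) / 2 ^ (2 * m + 3)"
proof -
  let ?E = "\<lambda>R. is_source V R b \<and> (a, s) \<notin> R\<^sup>*" and ?F = "\<lambda>R. is_sink V R a \<and> (s, b) \<notin> R\<^sup>*"
  have fin: "finite V" using assms(1) by (intro card_ge_0_finite) simp
  have card_less: "card (V - {v}) = m + 2" if "v \<in> V" for v
    using assms(1) fin that by simp
  have "2 * m + 3 = (m + 1) + (m + 2)" by simp
  then have power_split: "(2::real) ^ (2 * m + 3) = 2 ^ (m + 1) * 2 ^ (m + 2)"
    by (simp only: power_add)
  have source: "(s, b) \<notin> R\<^sup>*" if "R \<in> tournaments V" "is_source V R b" for R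
    using that assms by (intro source_unreachable[of R V b s]) auto
  have sink: "(a, s) \<notin> R\<^sup>*" if "R \<in> tournaments V" "is_sink V R a" for R
    using that assms by (intro sink_reaches_nothing[of R V a s]) auto
  have prob_E: "tournament_prob V ?E = scaled_miss m / 2 ^ (2 * m + 3)"
  proof -
    have "tournament_prob V ?E
        = tournament_prob V (\<lambda>R. is_source V R b \<and> (a, s) \<notin> (induced R (V - {b}))\<^sup>*)"
      using source_reach_iff[of _ V b a s] assms by (intro tournament_prob_cong) auto
    moreover have "\<dots> = tournament_prob (V - {b}) (\<lambda>R. (a, s) \<notin> R\<^sup>*) / 2 ^ (m + 2)"
      using tournament_prob_source[OF fin \<open>b \<in> V\<close>, of "\<lambda>R. (a, s) \<notin> R\<^sup>*"] assms(1) by simp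
    moreover have "tournament_prob (V - {b}) (\<lambda>R. (a, s) \<notin> R\<^sup>*) = scaled_miss m / 2 ^ (m + 1)"
      by (rule tournament_prob_miss) (use assms card_less in simp_all)
    ultimately show ?thesis by (simp only: power_split divide_divide_eq_left)
  qed
  have prob_F: "tournament_prob V ?F = scaled_miss m / 2 ^ (2 * m + 3)"
  proof -
    have "tournament_prob V ?F
        = tournament_prob V (\<lambda>R. is_sink V R a \<and> (s, b) \<notin> (induced R (V - {a}))\<^sup>*)"
      using sink_reach_iff[of _ V a b s] assms by (intro tournament_prob_cong) auto
    moreover have "\<dots> = tournament_prob (V - {a}) (\<lambda>R. (s, b) \<notin> R\<^sup>*) / 2 ^ (m + 2)"
      using tournament_prob_sink[OF fin \<open>a \<in> V\<close>, of "\<lambda>R. (s, b) \<notin> R\<^sup>*"] assms(1) by simp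
    moreover have "tournament_prob (V - {a}) (\<lambda>R. (s, b) \<notin> R\<^sup>*) = scaled_miss m / 2 ^ (m + 1)"
      by (rule tournament_prob_miss) (use assms card_less in simp_all)
    ultimately show ?thesis by (simp only: power_split divide_divide_eq_left)
  qed
  have prob_EF: "tournament_prob V (\<lambda>R. ?E R \<and> ?F R) = 1 / 2 ^ (2 * m + 3)"
  proof -
    let ?W = "V - {b}"
    \<comment> \<open>The arc from \<open>b\<close> to \<open>a\<close>, absent from the induced tournament, exists because \<open>b\<close> is a source.\<close>
    have sink_iff: "is_sink V R a \<longleftrightarrow> is_sink ?W (induced R ?W) a" if "is_source V R b" for R
      using that assms(2,4,7) by (auto simp: is_source_def is_sink_def induced_def)
    have "tournament_prob V (\<lambda>R. ?E R \<and> ?F R)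
        = tournament_prob V (\<lambda>R. is_source V R b \<and> is_sink ?W (induced R ?W) a)"
      using source sink sink_iff by (intro tournament_prob_cong) metis
    moreover have "\<dots> = tournament_prob ?W (\<lambda>R. is_sink ?W R a) / 2 ^ (m + 2)"
      using tournament_prob_source[OF fin \<open>b \<in> V\<close>, of "\<lambda>R. is_sink ?W R a"] assms(1) by simp
    moreover have "tournament_prob ?W (\<lambda>R. is_sink ?W R a) = 1 / 2 ^ (m + 1)"
      using tournament_prob_sink[of ?W a "\<lambda>_. True"] assms(2,7) fin card_less[OF \<open>b \<in> V\<close>]
        tournament_prob_True[of "?W - {a}"] by simp
    ultimately show ?thesis by (simp only: power_split divide_divide_eq_left)
  qed
  have "tournament_prob V (\<lambda>R. (is_source V R b \<or> is_sink V R a) \<and> (a, s) \<notin> R\<^sup>* \<and> (s, b) \<notin> R\<^sup>*)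
      = tournament_prob V (\<lambda>R. ?E R \<or> ?F R)"
    using source sink by (intro tournament_prob_cong) metis
  then show ?thesis
    using prob_EF
    by (simp add: tournament_prob_disj[OF fin, of ?E ?F] prob_E prob_F diff_divide_distrib)
qed

section \<open>The numerical comparison\<close>

lemma root_prob_values:
  "root_prob 0 = 1" "root_prob 1 = 1 / 2" "root_prob 2 = 1 / 2" "root_prob 3 = 19 / 32"
  "root_prob 4 = 91 / 128" "root_prob 5 = 1669 / 2048" "root_prob 6 = 116641 / 131072"
  "root_prob 7 = 15721787 / 16777216"
proof -
  note unroll = choose_reduce_nat lessThan_nat_numeral
  show r0: "root_prob 0 = 1" by (subst root_prob.simps) simp
  show r1: "root_prob 1 = 1 / 2" by (subst root_prob.simps) (simp add: r0)
  note r = r0 r1[unfolded One_nat_def]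
  show r2: "root_prob 2 = 1 / 2" by (subst root_prob.simps) (simp add: r unroll)
  note r = r r2
  show r3: "root_prob 3 = 19 / 32" by (subst root_prob.simps) (simp add: r unroll)
  note r = r r3
  show r4: "root_prob 4 = 91 / 128" by (subst root_prob.simps) (simp add: r unroll)
  note r = r r4
  show r5: "root_prob 5 = 1669 / 2048" by (subst root_prob.simps) (simp add: r unroll)
  note r = r r5
  show r6: "root_prob 6 = 116641 / 131072" by (subst root_prob.simps) (simp add: r unroll)
  note r = r r6
  show "root_prob 7 = 15721787 / 16777216" by (subst root_prob.simps) (simp add: r unroll)
qed

lemma scaled_miss_values:
  "scaled_miss 0 = 1" "scaled_miss 1 = 3 / 2" "scaled_miss 2 = 2" "scaled_miss 3 = 75 / 32"
  "scaled_miss 4 = 313 / 128" "scaled_miss 5 = 2421 / 1024" "scaled_miss 6 = 292369 / 131072"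
  "scaled_miss 7 = 35688945 / 16777216"
  using root_prob_values
  by (simp_all add: scaled_miss_def choose_reduce_nat atMost_nat_numeral)

text \<open>The expected number of ways to split a random tournament on \<open>m\<close> vertices into two nonempty parts
with all arcs between them pointing from the first part to the second.\<close>
definition expected_cuts :: "nat \<Rightarrow> real" where
  "expected_cuts m = (\<Sum>k\<in>{1..<m}. real (m choose k) / 2 ^ (k * (m - k)))"

text \<open>Almost everything comes from the two extreme sizes, which contribute \<open>m / 2 ^ (m - 1)\<close> each; for the
others the exponent is at least \<open>2 * (m - 2)\<close>, and there are fewer than \<open>2 ^ m\<close> sets in total.
The threshold \<open>8\<close> is where the resulting bound \<open>(4 * m + 16) / 2 ^ m\<close> equals \<open>3 / 16\<close>.\<close>
lemma expected_cuts_le: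
  assumes "8 \<le> m"
  shows "expected_cuts m \<le> 3 / 16"
proof -
  have middle: "real (m choose k) / 2 ^ (k * (m - k)) \<le> real (m choose k) / 2 ^ (2 * (m - 2))"
    if "k \<in> {2..<m - 1}" for k
  proof -
    obtain i j where "k = 2 + i" "m = k + 2 + j"
      using \<open>k \<in> {2..<m - 1}\<close> by (intro that[of "k - 2" "m - k - 2"]) auto
    then have "2 * (m - 2) \<le> k * (m - k)"
      by (simp add: algebra_simps)
    then show ?thesis
      by (intro divide_left_mono) (auto intro: power_increasing)
  qed
  have "{1..<m} = insert 1 (insert (m - 1) {2..<m - 1})"
    using assms by auto
  then have "expected_cuts m = 2 * (real m / 2 ^ (m - 1))
      + (\<Sum>k\<in>{2..<m - 1}. real (m choose k) / 2 ^ (k * (m - k)))"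
    using assms binomial_symmetric[of 1 m] by (simp add: expected_cuts_def)
  also have "\<dots> \<le> 2 * (real m / 2 ^ (m - 1)) + (\<Sum>k\<le>m. real (m choose k) / 2 ^ (2 * (m - 2)))"
    by (intro add_left_mono order.trans[OF sum_mono[OF middle] sum_mono2]) auto
  also have "(\<Sum>k\<le>m. real (m choose k) / 2 ^ (2 * (m - 2))) = 2 ^ m / 2 ^ (2 * (m - 2))"
    by (simp add: choose_row_sum flip: sum_divide_distrib of_nat_sum)
  also have "2 * (real m / 2 ^ (m - 1)) + 2 ^ m / 2 ^ (2 * (m - 2)) = (4 * real m + 16) / 2 ^ m"
  proof -
    obtain j where "m = j + 2" using assms by (intro that[of "m - 2"]) auto
    have double: "(2::real) ^ (2 * j) = 2 ^ j * 2 ^ j" by (simp add: mult_2 power_add)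
    have alg: "2 * ((c + 2) / (2 * x)) + 4 * x / (x * x) = (4 * (c + 2) + 16) / (4 * x)"
      if "0 < x" for x c :: real
      using that by (simp add: field_simps)
    show ?thesis
      using alg[of "2 ^ j" "real j"] by (simp add: double add_ac \<open>m = j + 2\<close>)
  qed
  also have "\<dots> \<le> 3 / 16"
  proof -
    have "64 * real m + 256 \<le> 3 * 2 ^ m"
      using assms by (induction m rule: dec_induct) auto
    then show ?thesis by (simp add: field_simps)
  qed
  finally show ?thesis .
qed

text \<open>If the root does not reach every vertex, there is a cut below which it lies.\<close>
lemma root_prob_ge: "1 - expected_cuts (Suc m) \<le> root_prob m"
proof -
  have "(\<Sum>k<m. real (m choose k) * root_prob k / 2 ^ ((k + 1) * (m - k)))
      \<le> (\<Sum>k<m. real (Suc m choose Suc k) / 2 ^ (Suc k * (Suc m - Suc k)))"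
  proof (rule sum_mono)
    fix k
    have "real (m choose k) * root_prob k \<le> real (Suc m choose Suc k) * 1"
      by (intro mult_mono) (use root_prob_le_1 root_prob_nonneg in auto)
    then show "real (m choose k) * root_prob k / 2 ^ ((k + 1) * (m - k))
      \<le> real (Suc m choose Suc k) / 2 ^ (Suc k * (Suc m - Suc k))"
      by (simp add: divide_right_mono)
  qed
  also have "\<dots> = expected_cuts (Suc m)"
    unfolding expected_cuts_def
    by (rule sum.reindex_bij_witness[of _ "\<lambda>k. k - 1" Suc]) auto
  finally show ?thesis by (subst root_prob.simps) simp
qed

text \<open>The summands of \<open>scaled_miss\<close> for \<open>k = 0\<close> and \<open>k = m\<close>, in which \<open>x\<close> is a sink or \<open>y\<close> is a source, are \<open>1\<close> and
\<open>root_prob m\<close>; the others are dominated by \<open>expected_cuts\<close>. So \<open>scaled_miss m \<le> 2 + 3/16\<close> and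
\<open>scaled_miss (m - 1) \<ge> 2 - 3/16\<close>, which is enough since \<open>(35/16)\<^sup>2 < 5 < 21/4\<close>.\<close>
lemma scaled_miss_square_less_large:
  assumes "8 \<le> m"
  shows "(scaled_miss m)\<^sup>2 < 4 * scaled_miss (m - 1) - 2"
proof -
  have ends: "{..k} = insert 0 (insert k {1..<k})" if "1 \<le> k" for k :: nat
    using that by auto
  have split: "scaled_miss k
      = 1 + root_prob k + (\<Sum>i\<in>{1..<k}. real (k choose i) * root_prob i / 2 ^ (i * (k - i)))"
    if "1 \<le> k" for k
    using that root_prob_values(1) unfolding scaled_miss_def ends[OF that] by simp
  have "(\<Sum>i\<in>{1..<m}. real (m choose i) * root_prob i / 2 ^ (i * (m - i))) \<le> expected_cuts m"
    unfolding expected_cuts_def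
    by (intro sum_mono divide_right_mono mult_left_le) (use root_prob_le_1 in auto)
  then have "scaled_miss m \<le> 2 + 3 / 16"
    using split[of m] root_prob_le_1[of m] expected_cuts_le[OF \<open>8 \<le> m\<close>] \<open>8 \<le> m\<close> by simp
  moreover have "0 \<le> scaled_miss m"
    unfolding scaled_miss_def by (intro sum_nonneg) (use root_prob_nonneg in auto)
  ultimately have "(scaled_miss m)\<^sup>2 \<le> (2 + 3 / 16)\<^sup>2"
    by (rule power_mono)
  moreover have "2 - 3 / 16 \<le> scaled_miss (m - 1)"
  proof -
    have "0 \<le> (\<Sum>i\<in>{1..<m - 1}. real ((m - 1) choose i) * root_prob i / 2 ^ (i * (m - 1 - i)))"
      by (intro sum_nonneg) (use root_prob_nonneg in auto)
    moreover have "1 - 3 / 16 \<le> root_prob (m - 1)"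
      using root_prob_ge[of "m - 1"] expected_cuts_le[OF \<open>8 \<le> m\<close>] \<open>8 \<le> m\<close> by simp
    ultimately show ?thesis
      using split[of "m - 1"] \<open>8 \<le> m\<close> by linarith
  qed
  ultimately show ?thesis by (simp add: power2_eq_square)
qed

text \<open>The estimates for \<open>8 \<le> m\<close> are too weak below that, where the exact values decide. At \<open>m = 2\<close> both
sides are \<open>4\<close>, which is the independence for four vertices.\<close>
lemma scaled_miss_square_less:
  assumes "3 \<le> m"
  shows "(scaled_miss m)\<^sup>2 < 4 * scaled_miss (m - 1) - 2"
proof (cases "8 \<le> m")
  case True
  then show ?thesis by (rule scaled_miss_square_less_large)
next
  case False
  then have "m = 3 \<or> m = 4 \<or> m = 5 \<or> m = 6 \<or> m = 7" using assms by linarith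
  then show ?thesis by (elim disjE) (simp_all add: scaled_miss_values power2_eq_square)
qed

section \<open>Correlation of the two events\<close>

lemma (in prob_space) indep_eventI:
  assumes "A \<in> events" "B \<in> events" "prob (A \<inter> B) = prob A * prob B"
  shows "indep_event A B"
  unfolding indep_event_def
proof (rule indep_eventsI)
  fix J :: "bool set" assume "J \<noteq> {}"
  then have "J \<in> {{True}, {False}, {False, True}}"
    using subset_UNIV[of J] unfolding UNIV_bool by blast
  then show "prob (\<Inter>i\<in>J. case_bool A B i) = (\<Prod>i\<in>J. prob (case_bool A B i))"
    using assms(3) by (auto simp: Int_commute mult.commute)
qed (use assms in \<open>auto split: bool.splits\<close>)

theorem theorem3p10:
  fixes n a s b :: nat
  assumes "n \<ge> 3"
    and "a \<in> {1..n}" and "s \<in> {1..n}" and "b \<in> {1..n}"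
    and "a \<noteq> s" and "s \<noteq> b" and "a \<noteq> b"
  shows "(n = 3 \<longrightarrow> negatively_correlated (measure_pmf (random_orientation n))
                     (no_path_event n a s) (no_path_event n s b)) \<and>
         (n = 4 \<longrightarrow> prob_space.indep_event (measure_pmf (random_orientation n))
                     (no_path_event n a s) (no_path_event n s b)) \<and>
         (n \<ge> 5 \<longrightarrow> positively_correlated (measure_pmf (random_orientation n))
                     (no_path_event n a s) (no_path_event n s b))"
proof -
  let ?V = "{1..n}" and ?A = "no_path_event n a s" and ?B = "no_path_event n s b"
  let ?P = "measure_pmf.prob (random_orientation n)"
  let ?both = "\<lambda>R. (a, s) \<notin> R\<^sup>* \<and> (s, b) \<notin> R\<^sup>*"
  obtain m where m: "n = m + 3" using \<open>3 \<le> n\<close> by (metis add.commute le_Suc_ex)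
  have event: "no_path_event n u v = {h. (u, v) \<notin> (arcs n h)\<^sup>*}" for u v
    by (auto simp: no_path_event_def path_event_def ex_dipath_iff_rtrancl)
  have "?P (no_path_event n u v) = scaled_miss (m + 1) / 2 ^ (m + 2)"
    if "u \<in> ?V" "v \<in> ?V" "u \<noteq> v" for u v
  proof -
    have "card ?V = (m + 1) + 2" using m by simp
    from tournament_prob_miss[OF this that] show ?thesis
      using prob_random_orientation[of n "\<lambda>R. (u, v) \<notin> R\<^sup>*"] by (simp add: event)
  qed
  then have "?P ?A * ?P ?B = (scaled_miss (m + 1) / 2 ^ (m + 2)) * (scaled_miss (m + 1) / 2 ^ (m + 2))"
    using assms by simp
  also have "\<dots> = (scaled_miss (m + 1))\<^sup>2 / 2 ^ (2 * m + 4)"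
  proof -
    have "2 * m + 4 = (m + 2) + (m + 2)" by simp
    then have "(2::real) ^ (2 * m + 4) = 2 ^ (m + 2) * 2 ^ (m + 2)"
      by (simp only: power_add)
    then show ?thesis
      by (simp only: power2_eq_square times_divide_times_eq)
  qed
  finally have product: "?P ?A * ?P ?B = (scaled_miss (m + 1))\<^sup>2 / 2 ^ (2 * m + 4)" .
  have "?A \<inter> ?B = {h. ?both (arcs n h)}"
    by (auto simp: event)
  then have both: "?P (?A \<inter> ?B) = tournament_prob ?V ?both"
    using prob_random_orientation[of n ?both] by simp
  have "(2 * scaled_miss m - 1) / 2 ^ (2 * m + 3) = (4 * scaled_miss m - 2) / 2 ^ (2 * m + 4)"
  proof -
    have "2 * m + 4 = Suc (2 * m + 3)" by simp
    then have "(2::real) ^ (2 * m + 4) = 2 * 2 ^ (2 * m + 3)"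
      by (simp only: power_Suc)
    moreover have "(2 * x - 1) / p = (4 * x - 2) / (2 * p)" for x p :: real
      by (cases "p = 0") (auto simp: field_simps)
    ultimately show ?thesis by (simp only:)
  qed
  then have extremal: "tournament_prob ?V (\<lambda>R. (is_source ?V R b \<or> is_sink ?V R a) \<and> ?both R)
      = (4 * scaled_miss m - 2) / 2 ^ (2 * m + 4)"
    using tournament_prob_source_or_sink[of ?V m a s b] assms m by simp
  have exact: "?P (?A \<inter> ?B) = (4 * scaled_miss m - 2) / 2 ^ (2 * m + 4)" if "n \<le> 4"
  proof -
    have "tournament_prob ?V ?both
        = tournament_prob ?V (\<lambda>R. (is_source ?V R b \<or> is_sink ?V R a) \<and> ?both R)"
    proof (rule tournament_prob_cong)
      fix R assume "R \<in> tournaments ?V"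
      then show "?both R \<longleftrightarrow> (is_source ?V R b \<or> is_sink ?V R a) \<and> ?both R"
        using source_or_sink_if_both_miss[of R ?V a s b] assms \<open>n \<le> 4\<close> by auto
    qed
    then show ?thesis using both extremal by simp
  qed
  have lower: "(4 * scaled_miss m - 2) / 2 ^ (2 * m + 4) \<le> ?P (?A \<inter> ?B)"
    unfolding both extremal[symmetric] by (rule tournament_prob_mono) auto
  show ?thesis
  proof (intro conjI impI)
    assume "n = 3"
    then have "m = 0" using m by simp
    then have "?P (?A \<inter> ?B) < ?P ?A * ?P ?B"
      using exact product \<open>n = 3\<close> scaled_miss_values(1) scaled_miss_values(2)[unfolded One_nat_def]
      by (simp add: power2_eq_square)
    then show "negatively_correlated (measure_pmf (random_orientation n)) ?A ?B"
      by (simp add: negatively_correlated_def)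
  next
    assume "n = 4"
    then have "m = 1" using m by simp
    then have "?P (?A \<inter> ?B) = ?P ?A * ?P ?B"
      using exact product \<open>n = 4\<close> scaled_miss_values(3) scaled_miss_values(2)[unfolded One_nat_def]
      by (simp add: power2_eq_square numeral_2_eq_2)
    then show "prob_space.indep_event (measure_pmf (random_orientation n)) ?A ?B"
      by (intro prob_space.indep_eventI prob_space_measure_pmf) simp_all
  next
    assume "5 \<le> n"
    then have "(scaled_miss (m + 1))\<^sup>2 < 4 * scaled_miss m - 2"
      using scaled_miss_square_less[of "m + 1"] m by simp
    then have "?P ?A * ?P ?B < (4 * scaled_miss m - 2) / 2 ^ (2 * m + 4)"
      unfolding product by (intro divide_strict_right_mono) auto
    then show "positively_correlated (measure_pmf (random_orientation n)) ?A ?B"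
      using lower by (simp add: positively_correlated_def)
  qed
qed

end
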